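(* Let $\mathcal{A}$ be a real tensor of order $m$ and dimension $n$. If all diagonal entries of $\mathcal{A}$ are positive and $\mathcal{A}$ is strictly diagonally dominant, then $\mathcal{A}$ is a strictly semi-positive tensor ($\mathbf{E}$-tensor).
   Context: A real tensor of order $m$ ($m\ge 2$) and dimension $n$ is an array $\mathcal{A}=(a_{i_1\ldots i_m})$ with $a_{i_1\ldots i_m}\in\mathbb{R}$, $i_1,\ldots,i_m\in I_n=\{1,\ldots,n\}$; its diagonal entries are $a_{ii\ldots i}$, $i\in I_n$. For $\mathbf{x}\in\mathbb{R}^n$, $\mathcal{A}\mathbf{x}^{m-1}\in\mathbb{R}^n$ is defined by $(\mathcal{A}\mathbf{x}^{m-1})_i=\sum_{i_2,\ldots,i_m=1}^n a_{i i_2\ldots i_m}x_{i_2}\cdots x_{i_m}$. Vector inequalities are componentwise. $\mathcal{A}$ is strictly diagonally dominant if $|a_{ii\ldots i}|>\sum_{(i_2,\ldots,i_m)\ne(i,\ldots,i)}|a_{ii_2\ldots i_m}|$ for all $i\in I_n$. $\mathcal{A}$ is strictly semi-positive ($\mathbf{E}$-tensor) if for each $\mathbf{x}\ge\mathbf{0}$, $\mathbf{x}\ne\mathbf{0}$, there is $k\in I_n$ with $x_k>0$ and $(\mathcal{A}\mathbf{x}^{m-1})_k> 0$. *)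

theory Defs
  imports "HOL-Analysis.Analysis"
begin

text \<open>
  The index set \<open>I\<^sub>n\<close> is the finite type \<open>'n\<close>, so \<open>n = CARD('n) \<ge> 1\<close>. A tensor of order \<open>m\<close> is
  a real function on index lists, where \<open>A [i\<^sub>1, \<dots>, i\<^sub>m]\<close> is the entry \<open>a\<close> with indices
  \<open>i\<^sub>1 \<dots> i\<^sub>m\<close>. The order is an explicit parameter \<open>m\<close> of the notions below, and for \<open>m \<ge> 1\<close>
  they only read \<open>A\<close> on lists of length \<open>m\<close>; values on other lists are irrelevant.
\<close>

type_synonym 'n tensor = "'n list \<Rightarrow> real"

definition diag_entry :: "nat \<Rightarrow> 'n tensor \<Rightarrow> 'n \<Rightarrow> real" where
  "diag_entry m A i = A (replicate m i)"

text \<open>The vector \<open>A x\<^sup>m\<^sup>-\<^sup>1\<close>; the list \<open>js\<close> is the multi-index \<open>(i\<^sub>2, \<dots>, i\<^sub>m)\<close>.\<close>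

definition tensor_apply :: "nat \<Rightarrow> 'n::finite tensor \<Rightarrow> real ^ 'n \<Rightarrow> real ^ 'n" where
  "tensor_apply m A x =
     (\<chi> i. \<Sum>js | length js = m - 1. A (i # js) * prod_list (map (\<lambda>j. x $ j) js))"

definition strictly_diag_dominant :: "nat \<Rightarrow> 'n::finite tensor \<Rightarrow> bool" where
  "strictly_diag_dominant m A \<longleftrightarrow>
     (\<forall>i. \<bar>diag_entry m A i\<bar> >
            (\<Sum>js | length js = m - 1 \<and> js \<noteq> replicate (m - 1) i. \<bar>A (i # js)\<bar>))"

text \<open>The order \<open>\<le>\<close> on \<open>real ^ 'n\<close> is the componentwise one (\<open>less_eq_vec_def\<close>).\<close>

definition strictly_semi_positive :: "nat \<Rightarrow> 'n::finite tensor \<Rightarrow> bool" where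
  "strictly_semi_positive m A \<longleftrightarrow>
     (\<forall>x. x \<ge> 0 \<and> x \<noteq> 0 \<longrightarrow> (\<exists>k. x $ k > 0 \<and> tensor_apply m A x $ k > 0))"

end

theory Submission
  imports Defs
begin

text \<open>
  Let \<open>x \<ge> 0\<close> be nonzero and let \<open>k\<close> be an index at which \<open>x\<close> attains its largest
  component, so that \<open>x\<^sub>k > 0\<close>. Every monomial \<open>x\<^sub>j\<^sub>2 \<cdots> x\<^sub>j\<^sub>m\<close> lies between \<open>0\<close> and the
  diagonal one, \<open>x\<^sub>k\<close> to the power \<open>m - 1\<close>. Hence the off-diagonal part of the \<open>k\<close>-th
  component of \<open>A x\<^sup>m\<^sup>-\<^sup>1\<close> is in absolute value at most that power times the sum of the absolute
  values of the off-diagonal entries of row \<open>k\<close>. By strict diagonal dominance this is less than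
  the diagonal term, which is positive, so the component is positive.
\<close>

lemma finite_lists_length: "finite {js :: 'a::finite list. length js = n}"
  using finite_lists_length_eq [of "UNIV :: 'a set" n] by simp

lemma prod_list_map_nonneg_le_power:
  fixes f :: "'a \<Rightarrow> real"
  assumes "\<And>j. 0 \<le> f j" and "\<And>j. f j \<le> c"
  shows "0 \<le> prod_list (map f js)" and "prod_list (map f js) \<le> c ^ length js"
proof -
  show nonneg: "0 \<le> prod_list (map f js)" for js
    by (induction js) (auto simp: assms)
  have "0 \<le> c"
    using assms order_trans by blast
  then show "prod_list (map f js) \<le> c ^ length js"
    by (induction js) (auto intro!: mult_mono simp: assms nonneg)
qed

lemma tensor_apply_split_diag:
  assumes "m \<ge> 1"
  shows "tensor_apply m A x $ i = diag_entry m A i * (x $ i) ^ (m - 1)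
    + (\<Sum>js | length js = m - 1 \<and> js \<noteq> replicate (m - 1) i.
         A (i # js) * prod_list (map (\<lambda>j. x $ j) js))"
proof -
  let ?d = "replicate (m - 1) i"
  have diag: "i # ?d = replicate m i"
    using assms by (cases m) auto
  have off: "{js. length js = m - 1} - {?d} = {js. length js = m - 1 \<and> js \<noteq> ?d}"
    by auto
  show ?thesis
    unfolding tensor_apply_def diag_entry_def
    by (simp add: sum.remove [OF finite_lists_length, of ?d] off diag del: One_nat_def)
qed

lemma tensor_apply_pos_at_max:
  fixes x :: "real ^ 'n::finite"
  assumes "m \<ge> 1" and "diag_entry m A k > 0" and "strictly_diag_dominant m A"
    and nonneg: "\<And>j. 0 \<le> x $ j" and max: "\<And>j. x $ j \<le> x $ k" and pos: "x $ k > 0"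
  shows "tensor_apply m A x $ k > 0"
proof -
  let ?J = "{js. length js = m - 1 \<and> js \<noteq> replicate (m - 1) k}"
  let ?p = "\<lambda>js. prod_list (map (\<lambda>j. x $ j) js)"
  let ?c = "(x $ k) ^ (m - 1)"
  have "\<bar>\<Sum>js\<in>?J. A (k # js) * ?p js\<bar> \<le> (\<Sum>js\<in>?J. \<bar>A (k # js) * ?p js\<bar>)"
    by (rule sum_abs)
  also have "\<dots> \<le> (\<Sum>js\<in>?J. \<bar>A (k # js)\<bar> * ?c)"
  proof (rule sum_mono)
    fix js assume "js \<in> ?J"
    then show "\<bar>A (k # js) * ?p js\<bar> \<le> \<bar>A (k # js)\<bar> * ?c"
      using prod_list_map_nonneg_le_power [of "\<lambda>j. x $ j" "x $ k" js, OF nonneg max]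
      by (auto simp: abs_mult intro!: mult_left_mono)
  qed
  also have "\<dots> = (\<Sum>js\<in>?J. \<bar>A (k # js)\<bar>) * ?c"
    by (simp add: sum_distrib_right)
  also have "\<dots> < diag_entry m A k * ?c"
  proof (rule mult_strict_right_mono)
    show "(\<Sum>js\<in>?J. \<bar>A (k # js)\<bar>) < diag_entry m A k"
      using assms(2,3) unfolding strictly_diag_dominant_def by (metis abs_of_pos)
    show "0 < ?c"
      using pos by simp
  qed
  finally show ?thesis
    unfolding tensor_apply_split_diag [OF \<open>m \<ge> 1\<close>] by linarith
qed

lemma nonneg_nonzero_vec_obtains_max:
  fixes x :: "real ^ 'n::finite"
  assumes "x \<ge> 0" and "x \<noteq> 0"
  obtains k where "\<And>j. x $ j \<le> x $ k" and "x $ k > 0"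
proof -
  obtain k where k: "\<And>j. x $ j \<le> x $ k"
    using Max_in [of "range (\<lambda>j. x $ j)"] Max_ge [of "range (\<lambda>j. x $ j)"] by fastforce
  obtain i where "x $ i \<noteq> 0"
    using \<open>x \<noteq> 0\<close> by (auto simp: vec_eq_iff)
  moreover have "0 \<le> x $ i"
    using \<open>x \<ge> 0\<close> by (simp add: less_eq_vec_def)
  ultimately have "x $ k > 0"
    using k [of i] by linarith
  with k show thesis
    by (rule that)
qed

theorem theorem3:
  fixes A :: "'n::finite tensor" and m :: nat
  assumes "m \<ge> 2"
    and "\<And>i. diag_entry m A i > 0"
    and "strictly_diag_dominant m A"
  shows "strictly_semi_positive m A"
  unfolding strictly_semi_positive_def
proof (intro allI impI, elim conjE)
  fix x :: "real ^ 'n"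
  assume x: "x \<ge> 0" "x \<noteq> 0"
  then obtain k where k: "\<And>j. x $ j \<le> x $ k" "x $ k > 0"
    using nonneg_nonzero_vec_obtains_max by blast
  have "0 \<le> x $ j" for j
    using x by (simp add: less_eq_vec_def)
  then have "tensor_apply m A x $ k > 0"
    using assms k by (intro tensor_apply_pos_at_max) auto
  with k show "\<exists>k. x $ k > 0 \<and> tensor_apply m A x $ k > 0"
    by blast
qed

end
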